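(* Let $\Delta_{\mathbb{Q}}:\mathbb{R}\to\mathbb{R}$ be defined by $\Delta_{\mathbb{Q}}(x)=0$ if $x\in\mathbb{Q}$ and $\Delta_{\mathbb{Q}}(x)=1$ otherwise. Let $V$ be $\mathbb{R}^2$ (with canonical basis $e_1,e_2$) endowed with the vector space diffeology generated by the two maps $p,q:\mathbb{R}\to\mathbb{R}^2$, $p(x)=(|x|,|x|)$ and $q(x)=(0,\Delta_{\mathbb{Q}}(x))$. Then $V$ decomposes as a smooth direct sum of $\mathrm{Span}(e_1)$ and $\mathrm{Span}(e_2)$. Moreover, the subset diffeology on $\mathrm{Span}(e_1)$ is the vector space diffeology generated by the map $x\mapsto(|x|,0)$, and the subset diffeology on $\mathrm{Span}(e_2)$ is the vector space diffeology generated by the maps $x\mapsto(0,|x|)$ and $x\mapsto(0,\Delta_{\mathbb{Q}}(x))$.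
   Context: A domain is an open subset of some $\mathbb{R}^n$. A diffeology on a set $X$ is a collection of maps $U\to X$ from domains $U$ (called plots) that contains all constant maps, is closed under pre-composition with ordinary smooth maps between domains, and satisfies the sheaf condition (a map $U\to X$ that is locally a plot is a plot). A map between diffeological spaces is smooth if its compositions with plots are plots. A diffeological vector space is a real vector space with a diffeology for which addition and scalar multiplication are smooth ($\mathbb{R}$ carrying its standard diffeology, whose plots are the ordinary smooth maps, and products carrying the product diffeology, whose plots are the maps with both components plots); such a diffeology is called a vector space diffeology. The vector space diffeology generated by a set of maps from domains into a vector space is the smallest vector space diffeology containing these maps. For finite-dimensional $V$ and generating maps $p_1,\dots,p_m$ defined on $\mathbb{R}$, its plots are locally the maps of the form $\alpha+\sum_{i=1}^{k}h_i\cdot(p_{j_i}\circ H_i)$ (finite sums), with $\alpha:U\to V$ and $h_i,H_i:U\to\mathbb{R}$ ordinary smooth maps. The subset diffeology on a subspace $W\subseteq V$ consists of the plots of $V$ with image in $W$. If $V=V_1\oplus V_2$ as a vector space, with $V_1,V_2$ vector subspaces, then $V$ is said to decompose as a smooth direct sum of $V_1$ and $V_2$ if the diffeology of $V$ coincides with the product diffeology on $V_1\oplus V_2$ relative to the subset diffeologies on $V_1$ and $V_2$ inherited from $V$. *)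

theory Defs
  imports "HOL-Analysis.Analysis"
begin

section \<open>Smooth maps between domains\<close>

text \<open>
  Since a diffeology involves domains of all finite dimensions at once, $\mathbb{R}^n$ is
  represented by the library topology \<^const>\<open>Euclidean_space\<close> \<open>n\<close>, whose points
  are the sequences \<open>x :: nat \<Rightarrow> real\<close> with \<open>x i = 0\<close> for \<open>i \<ge> n\<close>. A domain of
  $\mathbb{R}^n$ is a set \<open>U\<close> with \<open>openin (Euclidean_space n) U\<close>.

  \<open>Ck_on n k U f\<close>: the function \<open>f\<close> has continuous iterated partial derivatives on \<open>U\<close> up to
  order \<open>k\<close>. For \<open>i < n\<close> and \<open>U\<close> a domain of $\mathbb{R}^n$, \<open>u(i := t)\<close> stays in \<open>U\<close>
  for \<open>t\<close> near \<open>u i\<close>, so nothing here depends on the values of \<open>f\<close> outside \<open>U\<close>.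
\<close>

primrec Ck_on :: "nat \<Rightarrow> nat \<Rightarrow> (nat \<Rightarrow> real) set \<Rightarrow> ((nat \<Rightarrow> real) \<Rightarrow> real) \<Rightarrow> bool" where
  "Ck_on n 0 U f \<longleftrightarrow> continuous_on U f"
| "Ck_on n (Suc k) U f \<longleftrightarrow> continuous_on U f \<and>
     (\<forall>i<n. \<exists>g. (\<forall>u\<in>U. ((\<lambda>t. f (u(i := t))) has_real_derivative g u) (at (u i))) \<and>
                Ck_on n k U g)"

definition smooth_fun :: "nat \<Rightarrow> (nat \<Rightarrow> real) set \<Rightarrow> ((nat \<Rightarrow> real) \<Rightarrow> real) \<Rightarrow> bool" where
  "smooth_fun n U f \<longleftrightarrow> openin (Euclidean_space n) U \<and> (\<forall>k. Ck_on n k U f)"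

definition smooth_domain_map ::
  "nat \<Rightarrow> (nat \<Rightarrow> real) set \<Rightarrow> nat \<Rightarrow> (nat \<Rightarrow> real) set \<Rightarrow> ((nat \<Rightarrow> real) \<Rightarrow> nat \<Rightarrow> real) \<Rightarrow> bool"
where
  "smooth_domain_map m V n U H \<longleftrightarrow>
     openin (Euclidean_space m) V \<and> openin (Euclidean_space n) U \<and> H \<in> V \<rightarrow> U \<and>
     (\<forall>i<n. smooth_fun m V (\<lambda>v. H v i))"


section \<open>Diffeologies\<close>

text \<open>
  A map \<open>U \<rightarrow> X\<close> from a domain of $\mathbb{R}^n$ is encoded as a triple \<open>(n, U, p)\<close>, where only
  the values of \<open>p\<close> on \<open>U\<close> are meaningful. The rule \<open>plot_cong\<close> makes the set of plots
  independent of the junk values, so that equality of diffeologies is equality of sets.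
\<close>

type_synonym 'a parametrization = "nat \<times> (nat \<Rightarrow> real) set \<times> ((nat \<Rightarrow> real) \<Rightarrow> 'a)"

locale diffeology =
  fixes X :: "'a set" and D :: "'a parametrization set"
  assumes plot_domain: "(n, U, p) \<in> D \<Longrightarrow> openin (Euclidean_space n) U"
    and plot_into: "(n, U, p) \<in> D \<Longrightarrow> p \<in> U \<rightarrow> X"
    and plot_cong: "(n, U, p) \<in> D \<Longrightarrow> (\<And>u. u \<in> U \<Longrightarrow> p u = p' u) \<Longrightarrow> (n, U, p') \<in> D"
    and plot_const: "openin (Euclidean_space n) U \<Longrightarrow> c \<in> X \<Longrightarrow> (n, U, \<lambda>_. c) \<in> D"
    and plot_compose: "(n, U, p) \<in> D \<Longrightarrow> smooth_domain_map m V n U H \<Longrightarrow> (m, V, p \<circ> H) \<in> D"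
    and plot_local: "openin (Euclidean_space n) U \<Longrightarrow>
        (\<And>u. u \<in> U \<Longrightarrow> \<exists>V. openin (Euclidean_space n) V \<and> u \<in> V \<and> V \<subseteq> U \<and> (n, V, p) \<in> D) \<Longrightarrow>
        (n, U, p) \<in> D"

definition diffeo_smooth ::
  "'a parametrization set \<Rightarrow> 'b parametrization set \<Rightarrow> ('a \<Rightarrow> 'b) \<Rightarrow> bool" where
  "diffeo_smooth D E f \<longleftrightarrow> (\<forall>n U p. (n, U, p) \<in> D \<longrightarrow> (n, U, f \<circ> p) \<in> E)"

definition real_diffeology :: "real parametrization set" where
  "real_diffeology = {(n, U, f). smooth_fun n U f}"

definition prod_diffeology ::
  "'a parametrization set \<Rightarrow> 'b parametrization set \<Rightarrow> ('a \<times> 'b) parametrization set" where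
  "prod_diffeology D E = {(n, U, p). (n, U, fst \<circ> p) \<in> D \<and> (n, U, snd \<circ> p) \<in> E}"

definition subset_diffeology :: "'a parametrization set \<Rightarrow> 'a set \<Rightarrow> 'a parametrization set" where
  "subset_diffeology D W = {(n, U, p). (n, U, p) \<in> D \<and> p \<in> U \<rightarrow> W}"


section \<open>Vector space diffeologies\<close>

locale vector_space_diffeology = diffeology W D
  for W :: "'a::real_vector set" and D :: "'a parametrization set" +
  assumes subspace: "subspace W"
    and smooth_add: "diffeo_smooth (prod_diffeology D D) D (\<lambda>(v, w). v + w)"
    and smooth_scaleR: "diffeo_smooth (prod_diffeology real_diffeology D) D (\<lambda>(r, v). r *\<^sub>R v)"

definition generated_vs_diffeology ::
  "'a::real_vector set \<Rightarrow> 'a parametrization set \<Rightarrow> 'a parametrization set" where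
  "generated_vs_diffeology W G = \<Inter>{D. vector_space_diffeology W D \<and> G \<subseteq> D}"

text \<open>A map defined on $\mathbb{R}$, as a map defined on $\mathbb{R}^1$.\<close>

definition line_map :: "(real \<Rightarrow> 'a) \<Rightarrow> 'a parametrization" where
  "line_map p = (1, topspace (Euclidean_space 1), \<lambda>u. p (u 0))"

text \<open>
  The intersection above really is the smallest vector space diffeology containing \<open>G\<close>,
  provided \<open>G\<close> consists of maps from domains into \<open>W\<close>.
\<close>

lemma indiscrete_vector_space_diffeology:
  assumes "subspace W"
  shows "vector_space_diffeology W {(n, U, p). openin (Euclidean_space n) U \<and> p \<in> U \<rightarrow> W}"
proof (unfold_locales, goal_cases)
  case (1 n U p) then show ?case by simp
next
  case (2 n U p) then show ?case by simp
next
  case (3 n U p p') then show ?case by (simp add: Pi_iff)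
next
  case (4 n U c) then show ?case by simp
next
  case (5 n U p m V H) then show ?case by (simp add: smooth_domain_map_def Pi_iff)
next
  case (6 n U p)
  have "p u \<in> W" if "u \<in> U" for u
    using 6(2)[OF that] by (auto simp: Pi_iff)
  then show ?case using 6(1) by simp
next
  case 7 show ?case by (rule assms)
next
  case 8
  show ?case
    using assms
    by (auto simp: diffeo_smooth_def prod_diffeology_def Pi_iff case_prod_beta subspace_add)
next
  case 9
  show ?case
    using assms
    by (auto simp: diffeo_smooth_def prod_diffeology_def Pi_iff case_prod_beta subspace_scale)
qed

lemma generated_vs_diffeology_least:
  assumes "vector_space_diffeology W D" "G \<subseteq> D"
  shows "generated_vs_diffeology W G \<subseteq> D"
  using assms by (auto simp: generated_vs_diffeology_def)

lemma generated_vs_diffeology_superset: "G \<subseteq> generated_vs_diffeology W G"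
  by (auto simp: generated_vs_diffeology_def)

lemma vector_space_diffeology_generated:
  assumes W: "subspace W"
    and G: "\<And>n U p. (n, U, p) \<in> G \<Longrightarrow> openin (Euclidean_space n) U \<and> p \<in> U \<rightarrow> W"
  shows "vector_space_diffeology W (generated_vs_diffeology W G)"
proof -
  define \<D> where "\<D> = {D. vector_space_diffeology W D \<and> G \<subseteq> D}"
  define I where "I = {(n, U, p). openin (Euclidean_space n) U \<and> p \<in> U \<rightarrow> W}"
  have I: "I \<in> \<D>"
    using indiscrete_vector_space_diffeology[OF W] G by (auto simp: \<D>_def I_def)
  have gen: "generated_vs_diffeology W G = \<Inter>\<D>"
    by (simp add: generated_vs_diffeology_def \<D>_def)
  have vs: "vector_space_diffeology W D" if "D \<in> \<D>" for D
    using that by (simp add: \<D>_def)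
  have df: "diffeology W D" if "D \<in> \<D>" for D
    using vs[OF that] by (simp add: vector_space_diffeology_def)
  show ?thesis
    unfolding gen
  proof (unfold_locales, goal_cases)
    case (1 n U p) then show ?case using I by (auto simp: I_def)
  next
    case (2 n U p) then show ?case using I unfolding I_def by blast
  next
    case (3 n U p p') then show ?case by (auto intro: diffeology.plot_cong[OF df])
  next
    case (4 n U c) then show ?case by (auto intro: diffeology.plot_const[OF df])
  next
    case (5 n U p m V H) then show ?case by (auto intro: diffeology.plot_compose[OF df])
  next
    case (6 n U p)
    show ?case
    proof
      fix D assume D: "D \<in> \<D>"
      show "(n, U, p) \<in> D"
        by (rule diffeology.plot_local[OF df[OF D] 6(1)]) (use 6(2) D in blast)
    qed
  next
    case 7 show ?case by (rule W)
  next
    case 8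
    show ?case
      using vector_space_diffeology.smooth_add[OF vs]
      unfolding diffeo_smooth_def prod_diffeology_def by blast
  next
    case 9
    show ?case
      using vector_space_diffeology.smooth_scaleR[OF vs]
      unfolding diffeo_smooth_def prod_diffeology_def by blast
  qed
qed


section \<open>Smooth direct sums\<close>

text \<open>
  The product diffeology on the internal direct sum \<open>V1 \<oplus> V2\<close>: the plots of the product of
  \<open>V1\<close> and \<open>V2\<close> (with their subset diffeologies), transported along the bijection
  \<open>(v1, v2) \<mapsto> v1 + v2\<close>.
\<close>

definition direct_sum_diffeology ::
  "'a::real_vector parametrization set \<Rightarrow> 'a set \<Rightarrow> 'a set \<Rightarrow> 'a parametrization set" where
  "direct_sum_diffeology D V1 V2 =
     {(n, U, p). \<exists>r. (n, U, r) \<in> prod_diffeology (subset_diffeology D V1) (subset_diffeology D V2) \<and>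
                     (\<forall>u\<in>U. p u = fst (r u) + snd (r u))}"

definition smooth_direct_sum ::
  "'a::real_vector set \<Rightarrow> 'a parametrization set \<Rightarrow> 'a set \<Rightarrow> 'a set \<Rightarrow> bool" where
  "smooth_direct_sum V D V1 V2 \<longleftrightarrow>
     subspace V1 \<and> subspace V2 \<and> V = {v1 + v2 | v1 v2. v1 \<in> V1 \<and> v2 \<in> V2} \<and> V1 \<inter> V2 = {0} \<and>
     D = direct_sum_diffeology D V1 V2"

definition Delta_Q :: "real \<Rightarrow> real" where
  "Delta_Q x = (if x \<in> \<rat> then 0 else 1)"

end

theory Submission
  imports Defs
begin

text \<open>
  The generator \<open>p\<close> lies across the two axes, so the splitting can only hold if \<open>x \<mapsto> (0, \<bar>x\<bar>)\<close>
  is already a plot of \<open>V\<close>; then \<open>x \<mapsto> (\<bar>x\<bar>, 0)\<close> is one too, as the difference with \<open>p\<close>. The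
  whole theorem rests on the surprising fact that the Dirichlet function alone generates the
  absolute value (\<open>abs_line_map_from_Delta_Q\<close>). Since \<open>\<bar>x\<bar> = x - 2 x c(x)\<close>, where \<open>c\<close> is the
  indicator of \<open>x \<le> 0\<close>, it is enough to write \<open>c\<close> as a difference
  \<open>\<Delta> \<circ> G - \<Delta> \<circ> H\<close> with smooth \<open>G\<close> and \<open>H\<close>: both must be constant for \<open>x \<le> 0\<close>, the first with
  an irrational value and the second with a rational one, and yet they must be rational at exactly
  the same points \<open>x > 0\<close>.

  Such functions exist (\<open>smooth_rationality_independent_of_limit\<close>). Let \<open>t\<close> be a smooth step, equal
  to 1 for \<open>x \<le> 0\<close> and to 0 for \<open>x \<ge> 1\<close>. For a sequence of rationals \<open>c\<^sub>n\<close> strictly decreasing to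
  a given real \<open>L\<close>, put \<open>H\<^sub>L(x) = c\<^sub>0 + (\<Sum>n. (c\<^sub>n\<^sub>+\<^sub>1 - c\<^sub>n) t(2\<^sup>n x - 1))\<close>. For \<open>x \<le> 0\<close> the series
  telescopes to \<open>L\<close>. For \<open>x > 0\<close> it is a finite sum with rational coefficients in which at most one
  of the steps is strictly between its two end values, so \<open>H\<^sub>L(x)\<close> is rational iff all
  \<open>t(2\<^sup>n x - 1)\<close> are, a condition in which \<open>L\<close> does not occur. If \<open>c\<^sub>n\<close> tends to \<open>L\<close> as fast as
  \<open>1/n!\<close>, all termwise derivatives of the series converge uniformly, so \<open>H\<^sub>L\<close> is smooth.

  Once the generators of the two axes are known to be plots of \<open>V\<close>, the rest is formal
  (\<open>smooth_direct_sum_of_generated\<close>): the maps whose two coordinate projections are plots of the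
  diffeologies generated on the axes form a vector space diffeology containing \<open>p\<close> and \<open>q\<close>, hence
  all plots of \<open>V\<close>.
\<close>

section \<open>Smooth functions of one real variable\<close>

text \<open>
  Smoothness is coinductive: a smooth function is one with a smooth derivative. To show that a family
  of functions is smooth it then suffices that the family is closed under differentiation.
\<close>

coinductive smooth_real :: "(real \<Rightarrow> real) \<Rightarrow> bool" where
  "(\<And>x. (f has_real_derivative f' x) (at x)) \<Longrightarrow> smooth_real f' \<Longrightarrow> smooth_real f"

text \<open>
  Bounds on all derivatives are what makes the series of dilated copies below differentiable
  term by term.
\<close>

coinductive bounded_smooth :: "(real \<Rightarrow> real) \<Rightarrow> bool" where
  "bounded (range f) \<Longrightarrow> (\<And>x. (f has_real_derivative f' x) (at x)) \<Longrightarrow> bounded_smooth f' \<Longrightarrow> bounded_smooth f"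

lemma smooth_real_const: "smooth_real (\<lambda>_. c)"
proof (coinduction arbitrary: c)
  case smooth_real
  show ?case by (rule exI[of _ "\<lambda>_. c"], rule exI[of _ "\<lambda>_. 0"]) (auto intro!: derivative_eq_intros)
qed

lemma smooth_real_linear: "smooth_real (\<lambda>x. c * x)"
  by (rule smooth_real.intros[where f' = "\<lambda>_. c"])
     (auto intro!: derivative_eq_intros smooth_real_const)

lemma smooth_real_add_const:
  assumes "smooth_real f"
  shows "smooth_real (\<lambda>x. f x + c)"
proof -
  from assms obtain f' where f: "\<And>x. (f has_real_derivative f' x) (at x)" "smooth_real f'"
    by cases blast
  have "((\<lambda>x. f x + c) has_real_derivative f' x) (at x)" for x
    using DERIV_add[OF f(1) DERIV_const] by simp
  then show ?thesis using f(2) by (rule smooth_real.intros)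
qed

abbreviation line :: "(nat \<Rightarrow> real) set" where
  "line \<equiv> topspace (Euclidean_space 1)"

lemma smooth_fun_line:
  assumes "smooth_real f"
  shows "smooth_fun 1 line (\<lambda>u. f (u 0))"
proof -
  have "Ck_on 1 k line (\<lambda>u. f (u 0))" for k
    using assms
  proof (induction k arbitrary: f)
    have cont: "continuous_on line (\<lambda>u. f (u 0))" if "smooth_real f" for f
    proof -
      from that have "continuous_on UNIV f"
        by cases (auto intro: DERIV_continuous_on)
      moreover have "continuous_on line (\<lambda>u. u 0 :: real)"
        by (rule continuous_on_subset[OF continuous_on_product_coordinates]) simp
      ultimately show ?thesis
        by (rule continuous_on_compose2) simp
    qed
    case 0
    then show ?case using cont by simp
    case (Suc k)
    from \<open>smooth_real f\<close> obtain f' where "\<And>x. (f has_real_derivative f' x) (at x)" "smooth_real f'"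
      by cases blast
    then have "(\<forall>u\<in>line. ((\<lambda>t. f ((u(0 := t)) 0)) has_real_derivative f' (u 0)) (at (u 0))) \<and>
        Ck_on 1 k line (\<lambda>u. f' (u 0))"
      using Suc.IH by simp
    then show ?case using cont[OF Suc.prems] by auto
  qed
  then show ?thesis by (simp add: smooth_fun_def)
qed

section \<open>A smooth step\<close>

definition hump :: "real poly" where "hump = [:0, 1, -1:]"

text \<open>
  The function \<open>exp (- 1 / w)\<close> with \<open>w = x (1 - x)\<close>, extended by 0 outside the unit interval, is the
  usual bump. The factor \<open>P / w ^ m\<close> makes the family closed under differentiation.
\<close>

definition flat :: "real poly \<Rightarrow> nat \<Rightarrow> real \<Rightarrow> real" where
  "flat P m x = (if 0 < x \<and> x < 1
     then poly P x * exp (- 1 / poly hump x) / poly hump x ^ m else 0)"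

lemma poly_hump: "poly hump x = x * (1 - x)"
  by (simp add: hump_def algebra_simps)

text \<open>
  With \<open>y = 1 / w\<close> this says that \<open>y ^ m / m!\<close>, a single term of the exponential series, is
  at most \<open>exp y\<close>.
\<close>

lemma exp_inverse_le:
  fixes w :: real
  assumes "w > 0"
  shows "exp (- 1 / w) / w ^ m \<le> fact m"
proof -
  have "(1 / w) ^ m / fact m \<le> exp (1 / w)"
    using sum_le_suminf[OF summable_exp_generic[of "1 / w"], of "{m}"] assms
    by (simp add: exp_def divide_inverse mult.commute)
  then show ?thesis using assms
    by (simp add: exp_minus field_simps)
qed

text \<open>
  Splitting two factors \<open>w\<close> off the denominator leaves a bounded quotient, so the function is
  bounded by a multiple of \<open>w\<^sup>2\<close>, and \<open>w\<close> is at most the distance of \<open>x\<close> to any point outside the open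
  unit interval. The first estimate gives the derivative 0 at such points, the endpoints included.
\<close>

lemma flat_bound:
  obtains K where "\<And>x x0. x0 \<le> 0 \<or> x0 \<ge> 1 \<Longrightarrow> \<bar>flat P m x\<bar> \<le> K * (x - x0)\<^sup>2"
    and "\<And>x. \<bar>flat P m x\<bar> \<le> K"
proof -
  have "compact (poly P ` {0..1})"
    by (intro compact_continuous_image continuous_intros) auto
  then have "bounded (poly P ` {0..1})" by (rule compact_imp_bounded)
  then obtain C where C: "\<And>x. 0 \<le> x \<Longrightarrow> x \<le> 1 \<Longrightarrow> \<bar>poly P x\<bar> \<le> C"
    unfolding bounded_iff by (metis atLeastAtMost_iff imageI real_norm_def)
  define K where "K = C * fact (m + 2)"
  have C0: "C \<ge> 0" using C[of 0] by simp
  have K0: "K \<ge> 0" using C0 by (simp add: K_def)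
  have main: "\<bar>flat P m x\<bar> \<le> K * (x * (1 - x))\<^sup>2" if x: "0 < x" "x < 1" for x
  proof -
    define w where "w = x * (1 - x)"
    have w: "w > 0" using x by (simp add: w_def)
    have "\<bar>flat P m x\<bar> = \<bar>poly P x\<bar> * (exp (- 1 / w) / w ^ (m + 2)) * w\<^sup>2"
      using x w by (simp add: flat_def poly_hump w_def[symmetric] abs_mult power_add power2_eq_square)
    also have "\<dots> \<le> C * fact (m + 2) * w\<^sup>2"
      using w x C0 by (intro mult_right_mono mult_mono C exp_inverse_le) auto
    finally show ?thesis by (simp add: K_def w_def)
  qed
  show ?thesis
  proof
    fix x x0 :: real assume x0: "x0 \<le> 0 \<or> x0 \<ge> 1"
    show "\<bar>flat P m x\<bar> \<le> K * (x - x0)\<^sup>2"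
    proof (cases "0 < x \<and> x < 1")
      case True
      have "x * (1 - x) \<le> x" "x * (1 - x) \<le> 1 - x" "0 \<le> x * (1 - x)"
        using True by (auto simp: mult_left_le mult_left_le_one_le)
      then have "x * (1 - x) \<le> \<bar>x - x0\<bar>" "0 \<le> x * (1 - x)"
        using x0 by auto
      then have "(x * (1 - x))\<^sup>2 \<le> (x - x0)\<^sup>2"
        by (metis abs_of_nonneg abs_le_square_iff)
      then show ?thesis using main[of x] True K0
        by (meson mult_left_mono order_trans)
    next
      case False then show ?thesis using K0 by (auto simp: flat_def)
    qed
  next
    fix x
    show "\<bar>flat P m x\<bar> \<le> K"
    proof (cases "0 < x \<and> x < 1")
      case True
      then have "(x * (1 - x))\<^sup>2 \<le> 1"
        by (intro power_le_one mult_le_one) auto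
      then show ?thesis using main[of x] True K0
        by (meson mult_left_le order_trans)
    next
      case False then show ?thesis using K0 by (auto simp: flat_def)
    qed
  qed
qed

lemma DERIV_zero_of_quadratic_bound:
  fixes f :: "real \<Rightarrow> real"
  assumes "\<And>x. \<bar>f x\<bar> \<le> K * (x - x0)\<^sup>2"
  shows "(f has_real_derivative 0) (at x0)"
proof -
  have f0: "f x0 = 0" using assms[of x0] by simp
  have "((\<lambda>x. (f x - f x0) / (x - x0)) \<longlongrightarrow> 0) (at x0)"
  proof (rule Lim_null_comparison)
    show "\<forall>\<^sub>F x in at x0. norm ((f x - f x0) / (x - x0)) \<le> K * \<bar>x - x0\<bar>"
      unfolding eventually_at_filter
    proof (intro always_eventually allI impI)
      fix x assume "x \<noteq> x0"
      moreover have "\<bar>f x\<bar> \<le> K * (\<bar>x - x0\<bar> * \<bar>x - x0\<bar>)"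
        using assms[of x] by (simp add: power2_eq_square abs_mult[symmetric])
      ultimately show "norm ((f x - f x0) / (x - x0)) \<le> K * \<bar>x - x0\<bar>"
        by (simp add: f0 divide_simps mult.assoc)
    qed
    have "((\<lambda>x. K * \<bar>x - x0\<bar>) \<longlongrightarrow> K * \<bar>x0 - x0\<bar>) (at x0)"
      by (intro tendsto_intros)
    then show "((\<lambda>x. K * \<bar>x - x0\<bar>) \<longlongrightarrow> 0) (at x0)" by simp
  qed
  then show ?thesis by (simp add: has_field_derivative_iff)
qed

lemma flat_deriv:
  "(flat P m has_real_derivative
     flat (hump\<^sup>2 * pderiv P + (1 - of_nat m * hump) * pderiv hump * P) (m + 2) x) (at x)"
proof (cases "0 < x \<and> x < 1")
  case True
  define w where "w = poly hump"
  have w: "w x > 0" using True by (simp add: w_def poly_hump)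
  have "((\<lambda>x. poly P x * exp (- 1 / w x) / w x ^ m) has_real_derivative
      flat (hump\<^sup>2 * pderiv P + (1 - of_nat m * hump) * pderiv hump * P) (m + 2) x) (at x)"
  proof -
    define w' where "w' = poly (pderiv hump)"
    have dw: "(w has_real_derivative w' x) (at x)"
      unfolding w_def w'_def by (rule poly_DERIV)
    have "flat (hump\<^sup>2 * pderiv P + (1 - of_nat m * hump) * pderiv hump * P) (m + 2) x =
        ((w x)\<^sup>2 * poly (pderiv P) x + (1 - real m * w x) * w' x * poly P x) *
          exp (- 1 / w x) / w x ^ (m + 2)"
      using True by (simp add: flat_def w_def w'_def)
    \<comment> \<open>The right-hand side is the form that the quotient rule produces. The truncated exponent
      \<open>m - 1\<close> is harmless, as it comes with the factor \<open>m\<close>.\<close>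
    also have "\<dots> = ((poly (pderiv P) x * exp (- 1 / w x) +
          exp (- 1 / w x) * (w' x / (w x)\<^sup>2) * poly P x) * w x ^ m -
        poly P x * exp (- 1 / w x) * (real m * w x ^ (m - 1) * w' x)) / (w x ^ m * w x ^ m)"
      using w by (cases m) (simp_all add: field_simps power2_eq_square)
    finally show ?thesis
      using w
      by (auto intro!: derivative_eq_intros poly_DERIV dw simp: power2_eq_square)
  qed
  then show ?thesis
    apply (rule has_field_derivative_transform_within_open[of _ _ _ "{0<..<1}"])
    using True by (auto simp: flat_def w_def)
next
  case False
  obtain K where "\<And>x x0. x0 \<le> 0 \<or> x0 \<ge> 1 \<Longrightarrow> \<bar>flat P m x\<bar> \<le> K * (x - x0)\<^sup>2"
    using flat_bound[of P m] by metis
  then have "(flat P m has_real_derivative 0) (at x)"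
    using False by (intro DERIV_zero_of_quadratic_bound[where K = K]) auto
  moreover have "flat Q k x = 0" for Q k
    using False by (auto simp: flat_def)
  ultimately show ?thesis by simp
qed

lemma bounded_smooth_flat: "bounded_smooth (flat P m)"
proof (coinduction arbitrary: P m)
  case bounded_smooth
  obtain K where "\<And>x. \<bar>flat P m x\<bar> \<le> K"
    using flat_bound[of P m] by metis
  then have "bounded (range (flat P m))"
    by (auto simp: bounded_iff)
  then show ?case using flat_deriv[of P m] by blast
qed

text \<open>The step is a primitive of the bump, reflected and scaled to run from 1 to 0.\<close>

lemma smooth_step:
  obtains t where "bounded_smooth t" "\<And>x. x \<le> 0 \<Longrightarrow> t x = 1" "\<And>x. x \<ge> 1 \<Longrightarrow> t x = 0"
proof -
  define b where "b = flat 1 0"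
  have cont: "isCont b x" for x
    using flat_deriv[of 1 0] by (auto simp: b_def intro: DERIV_isCont)
  obtain B where "\<And>x. (B has_vector_derivative b x) (at x)"
    using einterval_antiderivative[of "-\<infinity>" "\<infinity>" b] cont by auto
  then have B: "\<And>x. (B has_real_derivative b x) (at x)"
    by (simp add: has_real_derivative_iff_has_vector_derivative)
  have Bcont: "continuous_on S B" for S
    using B by (meson DERIV_isCont continuous_at_imp_continuous_on)
  have b_pos: "b x > 0" if "0 < x" "x < 1" for x
    using that by (simp add: b_def flat_def)
  have "B 0 < B 1"
    by (rule DERIV_pos_imp_increasing_open[of 0 1])
       (use B b_pos Bcont in \<open>auto\<close>)
  have B': "(B has_real_derivative 0) (at x)" if "x \<le> 0 \<or> x \<ge> 1" for x
    using B[of x] that by (simp add: b_def flat_def split: if_splits)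
  have B0: "B x = B 0" if "x \<le> 0" for x
    using DERIV_isconst_end[of x 0 B] B' that Bcont by (cases "x = 0") auto
  have B1: "B x = B 1" if "x \<ge> 1" for x
    using DERIV_isconst_end[of 1 x B] B' that Bcont by (cases "x = 1") auto
  define t where "t x = (B 1 - B x) / (B 1 - B 0)" for x
  have t': "(t has_real_derivative flat [:- 1 / (B 1 - B 0):] 0 x) (at x)" for x
  proof -
    have "flat [:- 1 / (B 1 - B 0):] 0 x = (0 - b x) / (B 1 - B 0)"
      by (simp add: b_def flat_def)
    then show ?thesis unfolding t_def using \<open>B 0 < B 1\<close>
      by (auto intro!: derivative_eq_intros B)
  qed
  have mono: "B x \<le> B y" if "x \<le> y" for x y
  proof (rule DERIV_nonneg_imp_nondecreasing[OF that])
    have "b z \<ge> 0" for z using b_pos[of z] by (auto simp: b_def flat_def)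
    then show "\<exists>y. (B has_real_derivative y) (at z) \<and> 0 \<le> y" for z using B by blast
  qed
  have "\<bar>t x\<bar> \<le> 1" for x
  proof -
    have "B 0 \<le> B x" using mono[of 0 x] B0[of x] by linarith
    moreover have "B x \<le> B 1" using mono[of x 1] B1[of x] by linarith
    ultimately show ?thesis using \<open>B 0 < B 1\<close> by (simp add: t_def)
  qed
  then have "bounded (range t)" by (auto simp: bounded_iff)
  then have "bounded_smooth t" using t' bounded_smooth_flat by (rule bounded_smooth.intros)
  moreover have "t x = 1" if "x \<le> 0" for x
    using B0[OF that] \<open>B 0 < B 1\<close> by (simp add: t_def)
  moreover have "t x = 0" if "x \<ge> 1" for x
    using B1[OF that] by (simp add: t_def)
  ultimately show ?thesis by (rule that)
qed

section \<open>Smooth functions with prescribed rationality\<close>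

text \<open>
  The derivative is a series of the same kind, for \<open>t'\<close> and the coefficients \<open>a n * 2 ^ n\<close>; this is
  why the coefficients must remain summable against every power of \<open>2 ^ n\<close>.
\<close>

lemma smooth_real_dilation_series:
  assumes "bounded_smooth t" and "\<And>k. summable (\<lambda>n. \<bar>a n\<bar> * (2 ^ n) ^ k)"
  shows "smooth_real (\<lambda>x. \<Sum>n. a n * t (2 ^ n * x - 1))"
  using assms
proof (coinduction arbitrary: a t)
  case smooth_real
  have sa: "summable (\<lambda>n. \<bar>a n\<bar> * (2 ^ n) ^ k)" for k
    using smooth_real by blast
  from \<open>bounded_smooth t\<close> obtain t' where t: "bounded (range t)" "\<And>x. (t has_real_derivative t' x) (at x)" "bounded_smooth t'"
    by cases blast
  from t(3) have t': "bounded (range t')" by cases blast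
  obtain M where M: "\<And>x. \<bar>t x\<bar> \<le> M" using t(1) by (auto simp: bounded_iff)
  obtain M' where M': "\<And>x. \<bar>t' x\<bar> \<le> M'" using t' by (auto simp: bounded_iff)
  define a' where "a' n = a n * 2 ^ n" for n
  have sa': "summable (\<lambda>n. \<bar>a' n\<bar> * (2 ^ n) ^ k)" for k
    using sa[of "Suc k"] by (simp add: a'_def abs_mult mult.assoc)
  have conv: "uniformly_convergent_on UNIV (\<lambda>n x. \<Sum>i<n. a' i * t' (2 ^ i * x - 1))"
  proof (rule Weierstrass_m_test')
    show "norm (a' n * t' (2 ^ n * x - 1)) \<le> \<bar>a' n\<bar> * M'" for n x
      by (simp add: abs_mult mult_left_mono M')
    show "summable (\<lambda>n. \<bar>a' n\<bar> * M')"
      using sa'[of 0] by (simp add: summable_mult2)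
  qed
  have sum0: "summable (\<lambda>n. a n * t (2 ^ n * 0 - 1))"
  proof (rule summable_comparison_test')
    show "norm (a n * t (2 ^ n * 0 - 1)) \<le> \<bar>a n\<bar> * M" for n
      by (simp add: abs_mult mult_left_mono M)
    show "summable (\<lambda>n. \<bar>a n\<bar> * M)"
      using sa[of 0] by (simp add: summable_mult2)
  qed
  have der: "((\<lambda>x. \<Sum>n. a n * t (2 ^ n * x - 1)) has_real_derivative
      (\<Sum>n. a' n * t' (2 ^ n * x - 1))) (at x)" for x
  proof (rule has_field_derivative_series'(2)[where f = "\<lambda>n x. a n * t (2 ^ n * x - 1)"
        and S = UNIV and ?x0.0 = 0, OF convex_UNIV _ conv UNIV_I sum0])
    show "((\<lambda>x. a n * t (2 ^ n * x - 1)) has_real_derivative a' n * t' (2 ^ n * x - 1))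
            (at x within UNIV)" for n x
      by (auto simp: a'_def intro!: derivative_eq_intros DERIV_chain2[OF t(2)])
  qed simp
  show ?case
    by (intro exI[of _ "\<lambda>x. \<Sum>n. a n * t (2 ^ n * x - 1)"]
          exI[of _ "\<lambda>x. \<Sum>n. a' n * t' (2 ^ n * x - 1)"] conjI allI disjI1 exI[of _ a'] exI[of _ t']
          refl der t(3) sa')
qed

text \<open>
  Strict monotonicity makes all differences nonzero, so that a rational multiple
  \<open>(c (Suc n) - c n) * y\<close> forces \<open>y\<close> to be rational.
\<close>

lemma rapid_rational_approximation:
  fixes L :: real
  obtains c where "\<And>n. c n \<in> \<rat>" "\<And>n. c (Suc n) < c n" "c \<longlonglongrightarrow> L"
    "\<And>k. summable (\<lambda>n. \<bar>c (Suc n) - c n\<bar> * (2 ^ n) ^ k)"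
proof -
  \<comment> \<open>Disjoint intervals above \<open>L\<close>, one for each \<open>n\<close>; they start at index 1 because 0! = 1!.\<close>
  have "\<exists>c\<in>\<rat>. L + 1 / fact (Suc n) < c \<and> c < L + 1 / fact n" if "n > 0" for n
  proof (rule Rats_dense_in_real)
    have "(fact n :: real) < fact (Suc n)" using that by (intro fact_less_mono) auto
    then show "L + 1 / fact (Suc n) < L + 1 / fact n"
      by (simp add: divide_strict_left_mono del: fact_Suc)
  qed
  then have "\<forall>n. \<exists>c\<in>\<rat>. L + 1 / fact (Suc (Suc n)) < c \<and> c < L + 1 / fact (Suc n)" by blast
  then obtain c where c: "\<And>n. c n \<in> \<rat>" "\<And>n. L + 1 / fact (Suc (Suc n)) < c n"
      "\<And>n. c n < L + 1 / fact (Suc n)"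
    by metis
  have dec: "c (Suc n) < c n" for n
    using c(2)[of n] c(3)[of "Suc n"] by linarith
  have bnd: "\<bar>c n - L\<bar> \<le> 1 / fact n" for n
  proof -
    have "L < c n" using c(2)[of n] by (smt (verit) fact_gt_zero divide_pos_pos)
    moreover have "1 / fact (Suc n) \<le> (1 / fact n :: real)"
      by (intro divide_left_mono) (auto intro: fact_mono)
    ultimately show ?thesis using c(3)[of n] by linarith
  qed
  have "(\<lambda>n. c n - L) \<longlonglongrightarrow> 0"
  proof (rule Lim_null_comparison[OF always_eventually])
    show "\<forall>n. norm (c n - L) \<le> 1 / fact n" using bnd by simp
    show "(\<lambda>n. 1 / fact n :: real) \<longlonglongrightarrow> 0"
      using summable_LIMSEQ_zero[OF summable_exp[of "1::real"]] by (simp add: field_simps)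
  qed
  then have lim: "c \<longlonglongrightarrow> L" by (simp add: LIM_zero_iff)
  have "summable (\<lambda>n. \<bar>c (Suc n) - c n\<bar> * (2 ^ n) ^ k)" for k
  proof (rule summable_comparison_test')
    show "summable (\<lambda>n. inverse (fact n) * (2 ^ k) ^ n :: real)" by (rule summable_exp)
    show "norm (\<bar>c (Suc n) - c n\<bar> * (2 ^ n) ^ k) \<le> inverse (fact n) * (2 ^ k) ^ n" for n
    proof -
      have "L < c (Suc n)" using c(2)[of "Suc n"] by (smt (verit) fact_gt_zero divide_pos_pos)
      then have "\<bar>c (Suc n) - c n\<bar> \<le> inverse (fact n)"
        using bnd[of n] dec[of n] by (simp add: inverse_eq_divide)
      then show ?thesis
        by (simp add: abs_mult power_mult[symmetric] mult.commute[of k] mult_right_mono)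
    qed
  qed
  then show ?thesis using c(1) dec lim that by blast
qed

text \<open>
  The value \<open>L\<close> enters only through the rational coefficients of the steps, and these affect
  neither which step is active at a point \<open>x > 0\<close> nor whether its value there is rational.
\<close>

lemma smooth_rationality_independent_of_limit:
  obtains A :: "real set" where
    "\<And>L. \<exists>H. smooth_real H \<and> (\<forall>x\<le>0. H x = L) \<and> (\<forall>x>0. H x \<in> \<rat> \<longleftrightarrow> x \<in> A)"
proof -
  obtain t where t: "bounded_smooth t" "\<And>x. x \<le> 0 \<Longrightarrow> t x = 1" "\<And>x. x \<ge> 1 \<Longrightarrow> t x = 0"
    using smooth_step by blast
  define A where "A = {x. \<forall>n. t (2 ^ n * x - 1) \<in> \<rat>}"
  have "\<exists>H. smooth_real H \<and> (\<forall>x\<le>0. H x = L) \<and> (\<forall>x>0. H x \<in> \<rat> \<longleftrightarrow> x \<in> A)" for L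
  proof -
    obtain c where c: "\<And>n. c n \<in> \<rat>" "\<And>n. c (Suc n) < c n" "c \<longlonglongrightarrow> L"
      "\<And>k. summable (\<lambda>n. \<bar>c (Suc n) - c n\<bar> * (2 ^ n) ^ k)"
      by (rule rapid_rational_approximation[of L]) blast
    define a where "a n = c (Suc n) - c n" for n
    define H where "H x = (\<Sum>n. a n * t (2 ^ n * x - 1)) + c 0" for x
    have a: "a n \<in> \<rat>" "a n \<noteq> 0" for n
      using c(1,2)[of n] c(1)[of "Suc n"] by (auto simp: a_def)
    have "smooth_real (\<lambda>x. \<Sum>n. a n * t (2 ^ n * x - 1))"
      using t(1) c(4) unfolding a_def by (rule smooth_real_dilation_series)
    then have "smooth_real H"
      unfolding H_def by (rule smooth_real_add_const)
    moreover have "H x = L" if "x \<le> 0" for x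
    proof -
      have "t (2 ^ n * x - 1) = 1" for n
        using that by (intro t) (smt (verit) mult_nonneg_nonpos zero_le_power)
      moreover have "a sums (L - c 0)"
        unfolding a_def using c(3) by (rule telescope_sums)
      ultimately show ?thesis by (simp add: H_def sums_iff)
    qed
    moreover have "H x \<in> \<rat> \<longleftrightarrow> x \<in> A" if x: "x > 0" for x
    proof -
      obtain N where N: "2 / x < 2 ^ N"
        using real_arch_pow[of 2] by auto
      have vanish: "t (2 ^ n * x - 1) = 0" if "n \<ge> N" for n
      proof (rule t)
        have "(2::real) ^ N \<le> 2 ^ n" using that by simp
        then have "2 / x < 2 ^ n" using N by linarith
        then show "1 \<le> 2 ^ n * x - 1" using x by (simp add: field_simps)
      qed
      have Hsum: "H x = (\<Sum>n<N. a n * t (2 ^ n * x - 1)) + c 0"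
        unfolding H_def by (subst suminf_finite[of "{..<N}"]) (auto simp: vanish)
      show ?thesis
      proof
        assume "x \<in> A"
        then show "H x \<in> \<rat>"
          unfolding Hsum A_def by (intro Rats_add Rats_sum Rats_mult a c(1)) auto
      next
        assume HQ: "H x \<in> \<rat>"
        show "x \<in> A"
          unfolding A_def
        proof (intro CollectI allI)
          fix m
          show "t (2 ^ m * x - 1) \<in> \<rat>"
          proof (cases "0 < 2 ^ m * x - 1 \<and> 2 ^ m * x - 1 < 1")
            case False
            then show ?thesis using t(2)[of "2 ^ m * x - 1"] t(3)[of "2 ^ m * x - 1"]
              by (cases "2 ^ m * x - 1 \<le> 0") (auto simp: not_less)
          next
            case True
            \<comment> \<open>Here \<open>2 ^ m * x\<close> lies strictly between 1 and 2; any other power of 2 in place of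
              \<open>2 ^ m\<close> takes the product out of this interval, and outside it the step is 0 or 1.\<close>
            have other: "t (2 ^ n * x - 1) \<in> \<rat>" if "n \<noteq> m" for n
            proof (cases "n < m")
              case True
              then have "(2::real) ^ m \<ge> 2 ^ Suc n" by (intro power_increasing) auto
              then have "2 ^ m * x \<ge> 2 ^ Suc n * x" using x by simp
              then have "2 ^ n * x - 1 \<le> 0" using \<open>0 < 2 ^ m * x - 1 \<and> 2 ^ m * x - 1 < 1\<close> by simp
              then show ?thesis by (simp add: t(2))
            next
              case False
              then have "(2::real) ^ n \<ge> 2 ^ Suc m" using that by (intro power_increasing) auto
              then have "2 ^ n * x \<ge> 2 ^ Suc m * x" using x by simp
              then have "2 ^ n * x - 1 \<ge> 1" using \<open>0 < 2 ^ m * x - 1 \<and> 2 ^ m * x - 1 < 1\<close> by simp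
              then show ?thesis by (simp add: t(3))
            qed
            have "a m * t (2 ^ m * x - 1) \<in> \<rat>"
            proof (cases "m < N")
              case False then show ?thesis by (simp add: vanish)
            next
              case True
              then have "H x = a m * t (2 ^ m * x - 1) +
                  ((\<Sum>n\<in>{..<N} - {m}. a n * t (2 ^ n * x - 1)) + c 0)"
                unfolding Hsum by (subst sum.remove[of _ m]) auto
              moreover have "(\<Sum>n\<in>{..<N} - {m}. a n * t (2 ^ n * x - 1)) + c 0 \<in> \<rat>"
                by (intro Rats_add Rats_sum Rats_mult a c(1) other) auto
              ultimately show ?thesis using Rats_diff[OF HQ] by fastforce
            qed
            from Rats_divide[OF this a(1)[of m]] show ?thesis using a(2)[of m] by simp
          qed
        qed
      qed
    qed
    ultimately show ?thesis by blast
  qed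
  then show ?thesis by (rule that)
qed

lemma halfline_indicator_from_Delta_Q:
  obtains G H where "smooth_real G" "smooth_real H"
    "\<And>x. Delta_Q (G x) - Delta_Q (H x) = (if x \<le> 0 then 1 else 0)"
proof -
  obtain \<theta> :: real where \<theta>: "\<theta> \<notin> \<rat>"
    using countable_rat uncountable_UNIV_real countable_subset[of UNIV "\<rat>"]
    by (auto simp: subset_iff)
  obtain A :: "real set" where A:
    "\<And>L. \<exists>H. smooth_real H \<and> (\<forall>x\<le>0. H x = L) \<and> (\<forall>x>0. H x \<in> \<rat> \<longleftrightarrow> x \<in> A)"
    using smooth_rationality_independent_of_limit by blast
  obtain G where G: "smooth_real G" "\<forall>x\<le>0. G x = \<theta>" "\<forall>x>0. G x \<in> \<rat> \<longleftrightarrow> x \<in> A"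
    using A by blast
  obtain H where H: "smooth_real H" "\<forall>x\<le>0. H x = 0" "\<forall>x>0. H x \<in> \<rat> \<longleftrightarrow> x \<in> A"
    using A by blast
  show ?thesis
    by (rule that[OF G(1) H(1)]) (use \<theta> G H in \<open>auto simp: Delta_Q_def not_le\<close>)
qed


section \<open>Vector space diffeologies under linear maps\<close>

context vector_space_diffeology
begin

lemma plot_add:
  assumes "(n, U, p) \<in> D" "(n, U, q) \<in> D"
  shows "(n, U, \<lambda>u. p u + q u) \<in> D"
proof -
  have "(n, U, \<lambda>u. (p u, q u)) \<in> prod_diffeology D D"
    using assms by (simp add: prod_diffeology_def comp_def)
  then show ?thesis
    using smooth_add by (fastforce simp: diffeo_smooth_def comp_def)
qed

lemma plot_scaleR:
  assumes "smooth_fun n U h" "(n, U, p) \<in> D"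
  shows "(n, U, \<lambda>u. h u *\<^sub>R p u) \<in> D"
proof -
  have "(n, U, \<lambda>u. (h u, p u)) \<in> prod_diffeology real_diffeology D"
    using assms by (simp add: prod_diffeology_def real_diffeology_def comp_def)
  then show ?thesis
    using smooth_scaleR by (fastforce simp: diffeo_smooth_def comp_def)
qed

lemma line_map_add:
  assumes "line_map p \<in> D" "line_map q \<in> D"
  shows "line_map (\<lambda>x. p x + q x) \<in> D"
  using plot_add assms unfolding line_map_def by blast

lemma line_map_scaleR:
  assumes "smooth_real h" "line_map p \<in> D"
  shows "line_map (\<lambda>x. h x *\<^sub>R p x) \<in> D"
  using plot_scaleR[OF smooth_fun_line[OF assms(1)]] assms(2) unfolding line_map_def by blast

lemma line_map_const:
  assumes "c \<in> W"
  shows "line_map (\<lambda>_. c) \<in> D"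
  using plot_const[OF openin_topspace assms] by (simp add: line_map_def)

lemma line_map_compose:
  assumes "line_map p \<in> D" "smooth_real H"
  shows "line_map (\<lambda>x. p (H x)) \<in> D"
proof -
  have "smooth_domain_map 1 line 1 line (\<lambda>u i. if i = 0 then H (u 0) else 0)"
    using smooth_fun_line[OF assms(2)] openin_topspace[of "Euclidean_space 1"]
    by (auto simp: smooth_domain_map_def topspace_Euclidean_space)
  from plot_compose[OF assms(1)[unfolded line_map_def] this]
  show ?thesis by (simp add: line_map_def comp_def)
qed

lemma vector_space_diffeology_pullback:
  assumes f: "linear f" and V: "subspace V" and fV: "f \<in> V \<rightarrow> W"
  shows "vector_space_diffeology V {(n, U, p). p \<in> U \<rightarrow> V \<and> (n, U, f \<circ> p) \<in> D}"
proof (unfold_locales, goal_cases)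
  case (1 n U p) then show ?case by (auto dest: plot_domain)
next
  case (2 n U p) then show ?case by blast
next
  case (3 n U p p')
  then show ?case by (auto simp: Pi_iff elim: plot_cong)
next
  case (4 n U c)
  then show ?case using plot_const[of n U "f c"] fV by (auto simp: comp_def)
next
  case (5 n U p m V' H)
  then have "(m, V', (f \<circ> p) \<circ> H) \<in> D" by (blast intro: plot_compose)
  then show ?case using 5 by (auto simp: smooth_domain_map_def comp_def Pi_iff)
next
  case (6 n U p)
  have "p \<in> U \<rightarrow> V" using 6(2) by blast
  moreover have "(n, U, f \<circ> p) \<in> D"
    by (rule plot_local[OF 6(1)]) (use 6(2) in blast)
  ultimately show ?case by simp
next
  case 7 show ?case by (rule V)
next
  case 8
  show ?case
    using plot_add
    by (fastforce simp: diffeo_smooth_def prod_diffeology_def Pi_iff case_prod_beta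
        linear_add[OF f] subspace_add[OF V] comp_def)
next
  case 9
  show ?case
    using plot_scaleR
    by (fastforce simp: diffeo_smooth_def prod_diffeology_def real_diffeology_def Pi_iff
        case_prod_beta linear_scale[OF f] subspace_scale[OF V] comp_def)
qed

lemma vector_space_diffeology_subset:
  assumes "subspace V" "V \<subseteq> W"
  shows "vector_space_diffeology V (subset_diffeology D V)"
proof -
  have "subset_diffeology D V = {(n, U, p). p \<in> U \<rightarrow> V \<and> (n, U, id \<circ> p) \<in> D}"
    by (auto simp: subset_diffeology_def)
  moreover have "id \<in> V \<rightarrow> W" using assms(2) by auto
  ultimately show ?thesis
    using vector_space_diffeology_pullback[OF linear_id assms(1)] by simp
qed

end

text \<open>
  The maps that \<open>f\<close> sends to plots of \<open>D'\<close> form a vector space diffeology, so it suffices to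
  check a linear map on generators to know that it is smooth.
\<close>

lemma linear_image_of_generated_plot:
  assumes "vector_space_diffeology W' D'" "linear f" "subspace W" "f \<in> W \<rightarrow> W'"
    and G: "\<And>n U p. (n, U, p) \<in> G \<Longrightarrow> p \<in> U \<rightarrow> W \<and> (n, U, f \<circ> p) \<in> D'"
    and "(n, U, p) \<in> generated_vs_diffeology W G"
  shows "(n, U, f \<circ> p) \<in> D'"
proof -
  have "generated_vs_diffeology W G \<subseteq> {(n, U, p). p \<in> U \<rightarrow> W \<and> (n, U, f \<circ> p) \<in> D'}"
    by (intro generated_vs_diffeology_least
          vector_space_diffeology.vector_space_diffeology_pullback[OF assms(1-4)])
       (use G in blast)
  then show ?thesis using assms(6) by blast
qed

text \<open>
  By the hypothesis \<open>G\<close> the two projections are smooth into the diffeologies generated on the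
  summands, and by \<open>GD\<close> the inclusions of the summands are smooth. A plot with values in a summand is
  its own projection, which identifies the subset diffeologies; an arbitrary plot is the sum of its
  projections, which gives the product diffeology.
\<close>

lemma smooth_direct_sum_of_generated:
  fixes f1 f2 :: "'a::real_vector \<Rightarrow> 'a"
  assumes f: "linear f1" "linear f2" "\<And>v. f1 v + f2 v = v"
    and W: "subspace W1" "subspace W2"
    and f1: "\<And>v. f1 v \<in> W1" "\<And>w. w \<in> W1 \<Longrightarrow> f1 w = w"
    and f2: "\<And>v. f2 v \<in> W2" "\<And>w. w \<in> W2 \<Longrightarrow> f2 w = w"
    and D: "D = generated_vs_diffeology UNIV G" "vector_space_diffeology UNIV D"
    and D1: "D1 = generated_vs_diffeology W1 G1" "vector_space_diffeology W1 D1"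
    and D2: "D2 = generated_vs_diffeology W2 G2" "vector_space_diffeology W2 D2"
    and G: "\<And>n U p. (n, U, p) \<in> G \<Longrightarrow> (n, U, f1 \<circ> p) \<in> D1 \<and> (n, U, f2 \<circ> p) \<in> D2"
    and GD: "G1 \<subseteq> D" "G2 \<subseteq> D"
  shows "smooth_direct_sum UNIV D W1 W2 \<and> subset_diffeology D W1 = D1 \<and> subset_diffeology D W2 = D2"
proof -
  interpret D: vector_space_diffeology UNIV D by (rule D)
  interpret D1: vector_space_diffeology W1 D1 by (rule D1)
  interpret D2: vector_space_diffeology W2 D2 by (rule D2)
  have p1: "(n, U, f1 \<circ> p) \<in> D1" if "(n, U, p) \<in> D" for n U p
    by (rule linear_image_of_generated_plot[OF D1(2) f(1) subspace_UNIV])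
       (use that D(1) G f1(1) in auto)
  have p2: "(n, U, f2 \<circ> p) \<in> D2" if "(n, U, p) \<in> D" for n U p
    by (rule linear_image_of_generated_plot[OF D2(2) f(2) subspace_UNIV])
       (use that D(1) G f2(1) in auto)
  have "D1 \<subseteq> subset_diffeology D W1"
  proof -
    have "G1 \<subseteq> D1" unfolding D1(1) by (rule generated_vs_diffeology_superset)
    then have "G1 \<subseteq> subset_diffeology D W1"
      using GD(1) D1.plot_into unfolding subset_diffeology_def by blast
    then show ?thesis
      unfolding D1(1) by (intro generated_vs_diffeology_least D.vector_space_diffeology_subset W) auto
  qed
  moreover have "subset_diffeology D W1 \<subseteq> D1"
  proof (clarsimp simp: subset_diffeology_def)
    fix n U p assume "(n, U, p) \<in> D" "p \<in> U \<rightarrow> W1"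
    then show "(n, U, p) \<in> D1" using f1(2) by (intro D1.plot_cong[OF p1]) auto
  qed
  ultimately have sub1: "subset_diffeology D W1 = D1" by blast
  have "D2 \<subseteq> subset_diffeology D W2"
  proof -
    have "G2 \<subseteq> D2" unfolding D2(1) by (rule generated_vs_diffeology_superset)
    then have "G2 \<subseteq> subset_diffeology D W2"
      using GD(2) D2.plot_into unfolding subset_diffeology_def by blast
    then show ?thesis
      unfolding D2(1) by (intro generated_vs_diffeology_least D.vector_space_diffeology_subset W) auto
  qed
  moreover have "subset_diffeology D W2 \<subseteq> D2"
  proof (clarsimp simp: subset_diffeology_def)
    fix n U p assume "(n, U, p) \<in> D" "p \<in> U \<rightarrow> W2"
    then show "(n, U, p) \<in> D2" using f2(2) by (intro D2.plot_cong[OF p2]) auto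
  qed
  ultimately have sub2: "subset_diffeology D W2 = D2" by blast
  have "W1 \<inter> W2 = {0}"
  proof -
    have "w = 0" if "w \<in> W1" "w \<in> W2" for w
      using f(3)[of w] f1(2)[OF that(1)] f2(2)[OF that(2)] by simp
    then show ?thesis using W by (auto simp: subspace_0)
  qed
  moreover have "UNIV = {v1 + v2 | v1 v2. v1 \<in> W1 \<and> v2 \<in> W2}"
  proof -
    have "\<exists>v1 v2. v = v1 + v2 \<and> v1 \<in> W1 \<and> v2 \<in> W2" for v
      using f(3)[of v] f1(1)[of v] f2(1)[of v] by metis
    then show ?thesis by blast
  qed
  moreover have "D = direct_sum_diffeology D W1 W2"
  proof (intro set_eqI, clarify, rule iffI)
    fix n U p assume "(n, U, p) \<in> D"
    then have "(n, U, \<lambda>u. (f1 (p u), f2 (p u))) \<in> prod_diffeology D1 D2"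
      using p1 p2 by (simp add: prod_diffeology_def comp_def)
    moreover have "\<forall>u\<in>U. p u = fst (f1 (p u), f2 (p u)) + snd (f1 (p u), f2 (p u))"
      by (simp add: f(3))
    ultimately show "(n, U, p) \<in> direct_sum_diffeology D W1 W2"
      unfolding direct_sum_diffeology_def sub1 sub2 by (simp del: fst_conv snd_conv) blast
  next
    fix n U p assume "(n, U, p) \<in> direct_sum_diffeology D W1 W2"
    then obtain r where r: "(n, U, fst \<circ> r) \<in> D" "(n, U, snd \<circ> r) \<in> D"
        "\<And>u. u \<in> U \<Longrightarrow> p u = fst (r u) + snd (r u)"
      by (auto simp: direct_sum_diffeology_def prod_diffeology_def subset_diffeology_def)
    show "(n, U, p) \<in> D"
      by (rule D.plot_cong[OF D.plot_add[OF r(1,2)]]) (simp add: r(3))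
  qed
  ultimately show ?thesis
    using W sub1 sub2 by (simp add: smooth_direct_sum_def)
qed

section \<open>The diffeology generated by a diagonal absolute value and the Dirichlet function\<close>

lemma vector_space_diffeology_generated_by_line_maps:
  assumes "subspace W" "\<And>p x. p \<in> P \<Longrightarrow> p x \<in> W"
  shows "vector_space_diffeology W (generated_vs_diffeology W (line_map ` P))"
  by (rule vector_space_diffeology_generated) (use assms in \<open>auto simp: line_map_def\<close>)

text \<open>
  The formula \<open>\<bar>x\<bar> = x - 2 x c(x)\<close>, with the indicator \<open>c\<close> of \<open>x \<le> 0\<close> written in terms of
  the Dirichlet function.
\<close>

lemma abs_line_map_from_Delta_Q:
  assumes D: "vector_space_diffeology W D" and v: "v \<in> W"
    and q: "line_map (\<lambda>x. Delta_Q x *\<^sub>R v) \<in> D"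
  shows "line_map (\<lambda>x. \<bar>x\<bar> *\<^sub>R v) \<in> D"
proof -
  interpret D: vector_space_diffeology W D by (rule D)
  obtain G H where G: "smooth_real G" and H: "smooth_real H"
    and GH: "\<And>x. Delta_Q (G x) - Delta_Q (H x) = (if x \<le> 0 then 1 else 0)"
    using halfline_indicator_from_Delta_Q by blast
  have "line_map (\<lambda>x. (1 * x) *\<^sub>R v + ((- 2 * x) *\<^sub>R (Delta_Q (G x) *\<^sub>R v) +
      (2 * x) *\<^sub>R (Delta_Q (H x) *\<^sub>R v))) \<in> D"
    by (intro D.line_map_add D.line_map_scaleR smooth_real_linear D.line_map_const v
          D.line_map_compose[OF q] G H)
  moreover have "(1 * x) *\<^sub>R v + ((- 2 * x) *\<^sub>R (Delta_Q (G x) *\<^sub>R v) +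
      (2 * x) *\<^sub>R (Delta_Q (H x) *\<^sub>R v)) = \<bar>x\<bar> *\<^sub>R v" for x
  proof -
    have "(1 * x) *\<^sub>R v + ((- 2 * x) *\<^sub>R (Delta_Q (G x) *\<^sub>R v) +
        (2 * x) *\<^sub>R (Delta_Q (H x) *\<^sub>R v)) =
        (x - 2 * x * (Delta_Q (G x) - Delta_Q (H x))) *\<^sub>R v"
      by (simp add: algebra_simps)
    then show ?thesis unfolding GH by auto
  qed
  ultimately show ?thesis by simp
qed

theorem theorem2p3:
  fixes p q :: "real \<Rightarrow> real \<times> real"
    and e1 e2 :: "real \<times> real"
    and D :: "(real \<times> real) parametrization set"
  assumes "p = (\<lambda>x. (\<bar>x\<bar>, \<bar>x\<bar>))"
    and "q = (\<lambda>x. (0, Delta_Q x))"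
    and "e1 = (1, 0)"
    and "e2 = (0, 1)"
    and "D = generated_vs_diffeology UNIV {line_map p, line_map q}"
  shows "smooth_direct_sum UNIV D (span {e1}) (span {e2}) \<and>
    subset_diffeology D (span {e1}) =
      generated_vs_diffeology (span {e1}) {line_map (\<lambda>x. (\<bar>x\<bar>, 0))} \<and>
    subset_diffeology D (span {e2}) =
      generated_vs_diffeology (span {e2}) {line_map (\<lambda>x. (0, \<bar>x\<bar>)), line_map (\<lambda>x. (0, Delta_Q x))}"
proof -
  have span: "v \<in> span {e1} \<longleftrightarrow> snd v = 0" "v \<in> span {e2} \<longleftrightarrow> fst v = 0" for v
    by (cases v; auto simp: assms span_singleton)+
  let ?G1 = "{line_map (\<lambda>x. (\<bar>x\<bar>, 0))} :: (real \<times> real) parametrization set"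
  let ?G2 = "{line_map (\<lambda>x. (0, \<bar>x\<bar>)), line_map (\<lambda>x. (0, Delta_Q x))}
    :: (real \<times> real) parametrization set"
  define D1 where "D1 = generated_vs_diffeology (span {e1}) ?G1"
  define D2 where "D2 = generated_vs_diffeology (span {e2}) ?G2"
  have D: "vector_space_diffeology UNIV D"
    using vector_space_diffeology_generated_by_line_maps[of UNIV "{p, q}"] by (simp add: assms)
  have D1: "vector_space_diffeology (span {e1}) D1"
    using vector_space_diffeology_generated_by_line_maps[of "span {e1}" "{\<lambda>x. (\<bar>x\<bar>, 0)}"]
    by (simp add: D1_def span)
  have D2: "vector_space_diffeology (span {e2}) D2"
  proof -
    have "r x \<in> span {e2}" if "r \<in> {\<lambda>x. (0, \<bar>x\<bar>), \<lambda>x. (0, Delta_Q x)}" for r x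
      using that by (auto simp: span)
    then show ?thesis
      using vector_space_diffeology_generated_by_line_maps
        [of "span {e2}" "{\<lambda>x. (0, \<bar>x\<bar>), \<lambda>x. (0, Delta_Q x)}"]
      by (simp only: D2_def subspace_span image_insert image_empty)
  qed
  interpret D: vector_space_diffeology UNIV D by (rule D)
  interpret D1: vector_space_diffeology "span {e1}" D1 by (rule D1)
  have gen: "line_map p \<in> D" "line_map q \<in> D"
    using generated_vs_diffeology_superset unfolding assms(5) by blast+
  have gen1: "line_map (\<lambda>x. (\<bar>x\<bar>, 0)) \<in> D1"
    using generated_vs_diffeology_superset unfolding D1_def by blast
  have gen2: "line_map (\<lambda>x. (0, \<bar>x\<bar>)) \<in> D2" "line_map (\<lambda>x. (0, Delta_Q x)) \<in> D2"
    using generated_vs_diffeology_superset unfolding D2_def by blast+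
  \<comment> \<open>On the second axis \<open>q\<close> alone yields the absolute value; taking that away from \<open>p\<close> leaves
    the absolute value on the first axis.\<close>
  have vert: "line_map (\<lambda>x. (0, \<bar>x\<bar>)) \<in> D"
    using abs_line_map_from_Delta_Q[OF D, of e2] gen(2) by (simp add: assms(2,4))
  have "line_map (\<lambda>x. p x + (- 1) *\<^sub>R (0, \<bar>x\<bar>)) \<in> D"
    by (intro D.line_map_add D.line_map_scaleR gen vert smooth_real_const)
  then have horiz: "line_map (\<lambda>x. (\<bar>x\<bar>, 0)) \<in> D"
    by (simp add: assms(1))
  have "line_map (\<lambda>x. (0, 0)) \<in> D1"
    by (rule D1.line_map_const) (simp add: span)
  then have split: "(n, U, (\<lambda>v. (fst v, 0)) \<circ> r) \<in> D1 \<and> (n, U, (\<lambda>v. (0, snd v)) \<circ> r) \<in> D2"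
    if "(n, U, r) \<in> {line_map p, line_map q}" for n U r
    using that gen1 gen2 by (auto simp: line_map_def comp_def assms(1,2))
  show ?thesis
    unfolding D1_def[symmetric] D2_def[symmetric]
    by (rule smooth_direct_sum_of_generated[where ?f1.0 = "\<lambda>v. (fst v, 0)" and ?f2.0 = "\<lambda>v. (0, snd v)",
          OF _ _ _ subspace_span subspace_span _ _ _ _ assms(5) D D1_def D1 D2_def D2 split])
       (use gen vert horiz in \<open>auto simp: span assms(2) intro!: linearI\<close>)
qed

end
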